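(* Up to isometry of $\mathbb{R}^3$, any single-circleton can be obtained by dressing an $\omega$-wrapped circle of radius $1$ by a simple factor $h_{L,\alpha}$ with $L=[1:0]$, so of the form $$h_{L,\alpha}=\begin{pmatrix}\sqrt{\frac{\lambda-\alpha}{\lambda-\bar\alpha}}&0\\0&\sqrt{\frac{\lambda-\bar\alpha}{\lambda-\alpha}}\end{pmatrix},$$ with purely imaginary $\alpha\in(0,i)$ given by $$\alpha=\sqrt{\tfrac{k^2}{\omega^2}-1}=i\sqrt{1-\tfrac{k^2}{\omega^2}},\qquad k\in\mathbb{N},\ 1\le k<\omega .$$
   Context: Loop groups. For $r>0$ let $C_r=\{\lambda\in\mathbb{C}: |\lambda|=r\}$, $D_r=\{|\lambda|<r\}$, $E_r=\{|\lambda|>r\}\cup\{\infty\}$. $\Lambda_r\mathrm{SL}_2(\mathbb{C})$ is the group of analytic maps $C_r\to \mathrm{SL}_2(\mathbb{C})$; $\Lambda_r^{+}\mathrm{SL}_2(\mathbb C)$ (resp. $\Lambda_{r}^-\mathrm{SL}_2(\mathbb C)$) is the subgroup of those extending analytically to $D_r$ (resp. $E_r$) with values in $\mathrm{SL}_2(\mathbb{C})$; $\Lambda_{r,\mathbb 1}^-\mathrm{SL}_2(\mathbb C)$ is the subgroup of $g\in\Lambda_r^-\mathrm{SL}_2(\mathbb C)$ with $g(\infty)=\mathbb 1$. If $g\in \Lambda_r\mathrm{SL}_2(\mathbb{C})$ can be written (then uniquely) as $g=g_+g_-$ with $g_+\in\Lambda_r^+\mathrm{SL}_2(\mathbb C)$,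 $g_-\in\Lambda_{r,\mathbb 1}^-\mathrm{SL}_2(\mathbb C)$, write $(g)_+=g_+$. Dressing: $g\# h=(gh)_+$ for $g\in\Lambda_r^-\mathrm{SL}_2(\mathbb C)$, $h\in\Lambda_r^+\mathrm{SL}_2(\mathbb C)$. Simple factors. For $\alpha\in i\mathbb{R}\setminus\{0\}$ and $L\in\mathbb{CP}^1$, let $\pi_L$ be the Hermitian projection of $\mathbb{C}^2$ onto $L$, $\pi_L^\perp=\mathbb 1-\pi_L$, and $$h_{L,\alpha}(\lambda)=\frac{1}{\sqrt{1-\alpha^2\lambda^{-2}}}\bigl(\mathbb 1+\alpha\lambda^{-1}(\pi_L^\perp-\pi_L)\bigr),$$ with the branch of the root on $|\lambda|>|\alpha|$ equal to $1$ at $\lambda=\infty$. The points $\pm\alpha$ are its singularities; $h_{L,\alpha}\in\Lambda_{r,\mathbb 1}^-\mathrm{SL}_2(\mathbb C)$ for $r>|\alpha|$. Circles and circletons. Identify $\mathbb{R}^3\cong\mathfrak{su}_2$ with norm $|X|=\sqrt{\det X}$. The circle of radius $1$ has extended frame $F_\lambda(t)=\exp(tV_\lambda)$ with $V_\lambda=\frac12\begin{pmatrix} i\lambda&1\\-1&-i\lambda\end{pmatrix}$, and is $\gamma(t)=2\,(\partial_\lambda F_\lambda)F_\lambda^{-1}|_{\lambda=0}\in\mathfrak{su}_2$; for $\omega\in\mathbb{N}$ the $\omega$-wrapped circle is $\gamma$ on $[0,2\pi\omega]$. The curve dressed by $h_{L,\alpha}$ is $2(\partial_\lambda G_\lambda)G_\lambda^{-1}|_{\lambda=0}$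 with $G_\lambda(t)=h_{L,\alpha}\#F_\lambda(t)$ (taken with $r>|\alpha|$). The resonance points of the $\omega$-wrapped circle are the $\lambda\in\mathbb{C}$, $\lambda\neq\pm i$, with $F_\lambda(2\pi\omega)=\pm\mathbb 1$. A single-circleton is a closed (i.e. $2\pi\omega$-periodic) curve obtained by dressing a multiply wrapped ($\omega$-wrapped) circle of radius $1$ by one simple factor, whose singularities $\pm\alpha$ are resonance points off the real line.
   Formalization: The circle of radius 1 may be in any rotated position (extended frame U·F_λ with U in SU(2)), both for circletons and in the result; with the circle fixed to exp(tV_λ) the claim fails, e.g. for ω=2, k=1 and L an eigenline of V_α. *)

theory Defs
  imports "HOL-Analysis.Analysis"
begin

type_synonym cmat2 = "complex^2^2"

definition ctranspose :: "cmat2 \<Rightarrow> cmat2" where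
  "ctranspose A = (\<chi> i j. cnj (A $ j $ i))"

definition SU2 :: "cmat2 set" where
  "SU2 = {U. U ** ctranspose U = mat 1 \<and> det U = 1}"

(* The type of matrices carries no ring structure with matrix multiplication, so exp is not
   available; ((**) A ^^ n) (mat 1) is the n-th matrix power of A. *)
definition mexp :: "cmat2 \<Rightarrow> cmat2" where
  "mexp A = (\<Sum>n. ((**) A ^^ n) (mat 1) /\<^sub>R fact n)"

definition su2 :: "cmat2 set" where
  "su2 = {X. ctranspose X = - X \<and> trace X = 0}"

(* The determinant of an element of su2 is a non-negative real. *)
definition su2_norm :: "cmat2 \<Rightarrow> real" where
  "su2_norm X = sqrt (Re (det X))"

definition su2_isometry :: "(cmat2 \<Rightarrow> cmat2) \<Rightarrow> bool" where
  "su2_isometry \<Phi> \<longleftrightarrow> bij_betw \<Phi> su2 su2 \<and>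
     (\<forall>X\<in>su2. \<forall>Y\<in>su2. su2_norm (\<Phi> X - \<Phi> Y) = su2_norm (X - Y))"

definition analytic_SL2_on :: "(complex \<Rightarrow> cmat2) \<Rightarrow> complex set \<Rightarrow> bool" where
  "analytic_SL2_on g S \<longleftrightarrow>
     (\<forall>i j. (\<lambda>z. g z $ i $ j) analytic_on S) \<and> (\<forall>z\<in>S. det (g z) = 1)"

(* An element of a loop group is determined by its values on the circle of radius r. An element
   that extends analytically to one side is represented by its extension; values of the
   function elsewhere are irrelevant. *)
definition loop_plus :: "real \<Rightarrow> (complex \<Rightarrow> cmat2) set" where
  "loop_plus r = {g. analytic_SL2_on g (cball 0 r)}"

(* Analyticity on the exterior including the point at infinity is expressed in the coordinate
   w = 1/z of the Riemann sphere, so p 0 is the value of g at infinity. *)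
definition minus_extension :: "real \<Rightarrow> (complex \<Rightarrow> cmat2) \<Rightarrow> (complex \<Rightarrow> cmat2) \<Rightarrow> bool" where
  "minus_extension r g p \<longleftrightarrow>
     analytic_SL2_on p (cball 0 (1 / r)) \<and> (\<forall>z. r \<le> cmod z \<longrightarrow> g z = p (1 / z))"

definition loop_minus :: "real \<Rightarrow> (complex \<Rightarrow> cmat2) set" where
  "loop_minus r = {g. \<exists>p. minus_extension r g p}"

definition loop_minus_1 :: "real \<Rightarrow> (complex \<Rightarrow> cmat2) set" where
  "loop_minus_1 r = {g. \<exists>p. minus_extension r g p \<and> p 0 = mat 1}"

(* The partial operation taking g to its factor (g)_+ as a relation: the factorization
   exists and p is the plus factor, which is unique on the closed disc. *)
definition has_plus_factor ::
    "real \<Rightarrow> (complex \<Rightarrow> cmat2) \<Rightarrow> (complex \<Rightarrow> cmat2) \<Rightarrow> bool" where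
  "has_plus_factor r g p \<longleftrightarrow> p \<in> loop_plus r \<and>
     (\<exists>m\<in>loop_minus_1 r. \<forall>z\<in>sphere 0 r. g z = p z ** m z)"

(* k = g # h *)
definition dresses_to ::
    "real \<Rightarrow> (complex \<Rightarrow> cmat2) \<Rightarrow> (complex \<Rightarrow> cmat2) \<Rightarrow> (complex \<Rightarrow> cmat2) \<Rightarrow> bool" where
  "dresses_to r g h k \<longleftrightarrow> g \<in> loop_minus r \<and> h \<in> loop_plus r \<and>
     has_plus_factor r (\<lambda>z. g z ** h z) k"

definition CP1 :: "(complex^2) set set" where
  "CP1 = {L. vec.subspace L \<and> vec.dim L = 1}"

definition cp1_point :: "complex \<Rightarrow> complex \<Rightarrow> (complex^2) set" where
  "cp1_point a b = vec.span {vector [a, b]}"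

definition herm_proj :: "(complex^2) set \<Rightarrow> cmat2" where
  "herm_proj L = (THE P. P ** P = P \<and> ctranspose P = P \<and> range ((*v) P) = L)"

definition herm_proj_perp :: "(complex^2) set \<Rightarrow> cmat2" where
  "herm_proj_perp L = mat 1 - herm_proj L"

(* Used only for cmod z > cmod \<alpha>. There 1 - \<alpha>^2 / z^2 has positive real part, so the
   principal square root is the branch that equals 1 at infinity. Multiplication by mat c is
   multiplication by the scalar c. *)
definition simple_factor :: "(complex^2) set \<Rightarrow> complex \<Rightarrow> complex \<Rightarrow> cmat2" where
  "simple_factor L \<alpha> z =
     mat (1 / csqrt (1 - \<alpha>\<^sup>2 / z\<^sup>2)) **
       (mat 1 + mat (\<alpha> / z) ** (herm_proj_perp L - herm_proj L))"

definition V :: "complex \<Rightarrow> cmat2" where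
  "V z = (1 / 2) *\<^sub>R vector [vector [\<i> * z, 1], vector [-1, - \<i> * z]]"

definition circle_frame :: "real \<Rightarrow> complex \<Rightarrow> cmat2" where
  "circle_frame t z = mexp (t *\<^sub>R V z)"

definition curve_of_frame :: "(real \<Rightarrow> complex \<Rightarrow> cmat2) \<Rightarrow> real \<Rightarrow> cmat2" where
  "curve_of_frame G t =
     2 *\<^sub>R ((\<chi> i j. deriv (\<lambda>z. G t z $ i $ j) 0) ** matrix_inv (G t 0))"

(* The frame circle_frame describes one particular circle, with curve \<gamma> say; the frame
   U ** circle_frame t z describes the rotated circle U \<gamma> U^{-1}. Dressing by a fixed simple
   factor does not commute with rotations, so the position of the circle matters, and a circle
   of radius 1 is understood here to be any of these. *)
definition unit_circle_frames :: "(real \<Rightarrow> complex \<Rightarrow> cmat2) set" where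
  "unit_circle_frames = {\<lambda>t z. U ** circle_frame t z | U. U \<in> SU2}"

(* The dressed curve does not depend on the choice of r > cmod \<alpha>. *)
definition dressed_curve ::
    "(real \<Rightarrow> complex \<Rightarrow> cmat2) \<Rightarrow> (complex^2) set \<Rightarrow> complex \<Rightarrow> (real \<Rightarrow> cmat2) \<Rightarrow> bool" where
  "dressed_curve F L \<alpha> c \<longleftrightarrow>
     (\<exists>r > cmod \<alpha>. \<exists>G. (\<forall>t. dresses_to r (simple_factor L \<alpha>) (F t) (G t)) \<and>
        c = curve_of_frame G)"

definition resonance_points :: "nat \<Rightarrow> complex set" where
  "resonance_points \<omega> = {z. z \<noteq> \<i> \<and> z \<noteq> - \<i> \<and>
     (circle_frame (2 * pi * real \<omega>) z = mat 1 \<or>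
      circle_frame (2 * pi * real \<omega>) z = - mat 1)}"

definition single_circleton :: "nat \<Rightarrow> (real \<Rightarrow> cmat2) \<Rightarrow> bool" where
  "single_circleton \<omega> c \<longleftrightarrow>
     1 \<le> \<omega> \<and> range c \<subseteq> su2 \<and> (\<forall>t. c (t + 2 * pi * real \<omega>) = c t) \<and>
     (\<exists>F\<in>unit_circle_frames. \<exists>L\<in>CP1. \<exists>\<alpha>.
        Re \<alpha> = 0 \<and> \<alpha> \<noteq> 0 \<and>
        \<alpha> \<in> resonance_points \<omega> - \<real> \<and> - \<alpha> \<in> resonance_points \<omega> - \<real> \<and>
        dressed_curve F L \<alpha> c)"

end

theory Submission
  imports Defs
begin

text \<open>
  For \<open>W \<in> SU\<^sub>2\<close> the factorization \<open>h F = G m\<close> gives \<open>(W h W\<^sup>*) (W F) = (W G) m\<close>.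
  So dressing the rotated frame \<open>W F\<close> by \<open>W h W\<^sup>*\<close> yields the rotated curve \<open>W c W\<^sup>*\<close>,
  and \<open>W h\<^bsub>L,\<alpha>\<^esub> W\<^sup>* = h\<^bsub>WL,\<alpha>\<^esub>\<close>, where \<open>W\<close> can be chosen with \<open>W L = [1:0]\<close>. The sign of
  \<open>\<alpha>\<close> does not matter because \<open>h\<^bsub>L,-\<alpha>\<^esub>\<close> is the simple factor of \<open>\<alpha>\<close> and the line orthogonal
  to \<open>L\<close>. The resonance points come from \<open>V\<^sub>\<lambda>\<^sup>2 = - (1 + \<lambda>\<^sup>2) / 4\<close>: the off-diagonal entry of the
  frame at \<open>2 \<pi> \<omega>\<close> is a non-zero multiple of \<open>sin \<theta> / \<theta>\<close> with
  \<open>\<theta>\<^sup>2 = (\<pi> \<omega>)\<^sup>2 (1 + \<lambda>\<^sup>2)\<close>, so \<open>1 + \<lambda>\<^sup>2 = k\<^sup>2 / \<omega>\<^sup>2\<close> for an integer \<open>k\<close>.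
\<close>

section \<open>Complex two-by-two matrices and the group \<open>SU2\<close>\<close>

lemma cmat2_eqI:
  fixes A B :: cmat2
  assumes "A $ 1 $ 1 = B $ 1 $ 1" "A $ 1 $ 2 = B $ 1 $ 2" "A $ 2 $ 1 = B $ 2 $ 1" "A $ 2 $ 2 = B $ 2 $ 2"
  shows "A = B"
  using assms by (simp add: vec_eq_iff forall_2)

lemma cmat2_mult_nth [simp]: "((A :: cmat2) ** B) $ i $ j = A $ i $ 1 * B $ 1 $ j + A $ i $ 2 * B $ 2 $ j"
  by (simp add: matrix_matrix_mult_def sum_2)

lemma ctranspose_nth [simp]: "ctranspose A $ i $ j = cnj (A $ j $ i)"
  by (simp add: ctranspose_def)

lemma mat_nth: "mat x $ i $ j = (if i = j then x else 0)"
  by (simp add: mat_def)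

lemma ctranspose_mult: "ctranspose (A ** B) = ctranspose B ** ctranspose A"
  by (rule cmat2_eqI) (simp_all add: algebra_simps)

lemma ctranspose_ctranspose [simp]: "ctranspose (ctranspose A) = A"
  by (rule cmat2_eqI) simp_all

lemma det_ctranspose: "det (ctranspose A) = cnj (det A)"
  by (simp add: det_2)

lemma SU2_D:
  assumes "W \<in> SU2"
  shows "W ** ctranspose W = mat 1" "ctranspose W ** W = mat 1" "det W = 1" "det (ctranspose W) = 1"
  using assms matrix_left_right_inverse[of W "ctranspose W"] by (auto simp: SU2_def det_ctranspose)

lemma SU2_ctranspose: "W \<in> SU2 \<Longrightarrow> ctranspose W \<in> SU2"
  by (simp add: SU2_D SU2_def[THEN eqset_imp_iff, of "ctranspose W"])

lemma SU2_cancel: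
  assumes "W \<in> SU2"
  shows "ctranspose W ** (W ** A) = A" "W ** (ctranspose W ** A) = A"
    "A ** W ** ctranspose W = A" "A ** ctranspose W ** W = A"
  using SU2_D[OF assms] by (simp_all add: matrix_mul_assoc) (simp_all flip: matrix_mul_assoc)

lemma SU2_mult: "U \<in> SU2 \<Longrightarrow> W \<in> SU2 \<Longrightarrow> U ** W \<in> SU2"
  by (simp add: SU2_def[THEN eqset_imp_iff, of "U ** W"] ctranspose_mult det_mul matrix_mul_assoc
      SU2_cancel SU2_D)

lemma mat_comm: "mat x ** (A :: cmat2) = A ** mat x"
  by (rule cmat2_eqI) (simp_all add: mat_nth mult.commute)

text \<open>Scalar matrices are central. Together with \<open>add_conj\<close> and
  \<open>scaleR_conj\<close> this is linearity of the map sending \<open>B\<close> to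
  \<open>A ** B ** C\<close>, used below mostly for conjugations.\<close>

lemma mat_mult_conj: "mat x ** (A ** B ** C) = A ** (mat x ** B) ** C"
  for A B C :: cmat2
  by (simp add: matrix_mul_assoc mat_comm[of x A])

lemma add_conj: "A ** (B + C) ** D = A ** B ** D + A ** C ** D"
  for A B C D :: cmat2
  by (rule cmat2_eqI) (simp_all add: algebra_simps)

lemma scaleR_conj: "A ** (x *\<^sub>R B) ** C = x *\<^sub>R (A ** B ** C)"
  for A B C :: cmat2
  by (rule cmat2_eqI) (simp_all add: algebra_simps)

text \<open>\<open>matrix_inv\<close> is a choice among two-sided inverses. For square matrices a
  right inverse is two-sided, and a two-sided inverse is unique, so the choice is forced.\<close>

lemma matrix_inv_eq:
  fixes A B :: cmat2
  assumes "A ** B = mat 1"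
  shows "matrix_inv A = B"
proof -
  have BA: "B ** A = mat 1"
    using assms by (simp add: matrix_left_right_inverse)
  have "A ** matrix_inv A = mat 1 \<and> matrix_inv A ** A = mat 1"
    unfolding matrix_inv_def by (rule someI[of _ B]) (simp add: assms BA)
  then show ?thesis
    by (metis BA matrix_mul_assoc matrix_mul_lid matrix_mul_rid)
qed

subsection \<open>Isometries of \<open>\<real>\<^sup>3\<close>\<close>

lemma su2_conj:
  assumes "W \<in> SU2" "X \<in> su2"
  shows "W ** X ** ctranspose W \<in> su2"
proof -
  have X: "ctranspose X = - X" "trace X = 0"
    using assms(2) by (auto simp: su2_def)
  have "trace (W ** X ** ctranspose W) = 0"
    using X(2) trace_mul_sym[of "W ** X" "ctranspose W"] by (simp add: SU2_cancel[OF assms(1)])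
  moreover have "ctranspose (W ** X ** ctranspose W) = W ** - X ** ctranspose W"
    by (simp add: ctranspose_mult X(1) matrix_mul_assoc)
  moreover have "W ** - X ** ctranspose W = - (W ** X ** ctranspose W)"
    by (rule cmat2_eqI) (simp_all add: algebra_simps)
  ultimately show ?thesis
    by (simp add: su2_def)
qed

text \<open>The norm is the root of a determinant, which conjugation by \<open>W\<close> preserves;
  the inverse map is conjugation by \<open>ctranspose W\<close>.\<close>

lemma su2_isometry_conj:
  assumes W: "W \<in> SU2"
  shows "su2_isometry (\<lambda>X. W ** X ** ctranspose W)"
proof -
  have "bij_betw (\<lambda>X. W ** X ** ctranspose W) su2 su2"
    by (rule bij_betw_byWitness[where f' = "\<lambda>X. ctranspose W ** X ** W"])
      (use su2_conj[OF W] su2_conj[OF SU2_ctranspose[OF W]] in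
        \<open>auto simp: matrix_mul_assoc SU2_D[OF W] SU2_cancel[OF W]\<close>)
  moreover have "det (W ** X ** ctranspose W - W ** Y ** ctranspose W) = det (X - Y)" for X Y
  proof -
    have "W ** X ** ctranspose W - W ** Y ** ctranspose W = W ** (X - Y) ** ctranspose W"
      by (rule cmat2_eqI) (simp_all add: algebra_simps)
    then show ?thesis
      using SU2_D[OF W] by (simp add: det_mul)
  qed
  ultimately show ?thesis
    by (simp add: su2_isometry_def su2_norm_def)
qed

subsection \<open>Simple factors\<close>

text \<open>Normalising the spanning vector lets the projection onto the line be written without
  denominators.\<close>

lemma CP1_unit_vector:
  assumes "L \<in> CP1"
  obtains a b where "a * cnj a + b * cnj b = 1" "L = cp1_point a b"
proof -
  obtain B where B: "B \<subseteq> L" "vec.independent B" "L \<subseteq> vec.span B" "card B = 1"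
    using assms vec.basis_exists[of L] unfolding CP1_def by (metis (lifting) mem_Collect_eq)
  obtain v where v: "B = {v}"
    using B(4) by (rule card_1_singletonE)
  have "L = vec.span {v}"
    using B(1,3) v assms vec.span_minimal[of B L] by (simp add: CP1_def subset_antisym)
  have "v \<noteq> 0"
    using B v by (simp add: vec.dependent_single)
  define s where "s = sqrt ((cmod (v $ 1))\<^sup>2 + (cmod (v $ 2))\<^sup>2)"
  have "(cmod (v $ 1))\<^sup>2 + (cmod (v $ 2))\<^sup>2 > 0"
    using \<open>v \<noteq> 0\<close> by (auto simp: vec_eq_iff forall_2 sum_power2_gt_zero_iff)
  then have s: "s > 0" "s\<^sup>2 = (cmod (v $ 1))\<^sup>2 + (cmod (v $ 2))\<^sup>2"
    by (simp_all add: s_def)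
  define a b where "a = v $ 1 / of_real s" and "b = v $ 2 / of_real s"
  have "a * cnj a + b * cnj b = of_real (((cmod (v $ 1))\<^sup>2 + (cmod (v $ 2))\<^sup>2) / s\<^sup>2)"
  proof -
    have "x / of_real s * cnj (x / of_real s) = of_real ((cmod x)\<^sup>2 / s\<^sup>2)" for x
      using complex_norm_square[of x] by (simp add: power2_eq_square)
    then show ?thesis by (simp add: a_def b_def add_divide_distrib)
  qed
  also have "((cmod (v $ 1))\<^sup>2 + (cmod (v $ 2))\<^sup>2) / s\<^sup>2 = 1"
    unfolding s(2)[symmetric] using s(1) by simp
  finally have ab: "a * cnj a + b * cnj b = 1" by simp
  have v_eq: "v = of_real s *s vector [a, b]"
    using s(1) by (simp add: a_def b_def vec_eq_iff forall_2)
  have "vec.span {v} = cp1_point a b"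
  proof -
    have "v \<in> cp1_point a b"
      unfolding cp1_point_def by (subst v_eq) (intro vec.span_scale vec.span_base, simp)
    moreover have "vector [a, b] = of_real (1 / s) *s v"
      using s(1) by (simp add: a_def b_def vec_eq_iff forall_2)
    then have "vector [a, b] \<in> vec.span {v}"
      by (metis insertI1 vec.span_base vec.span_scale)
    ultimately show ?thesis
      unfolding cp1_point_def by (simp add: vec.span_minimal subset_antisym)
  qed
  with \<open>L = vec.span {v}\<close> ab that show thesis by blast
qed

text \<open>For a unit column v the projection onto its span is v v^*.\<close>

lemma herm_proj_cp1_point:
  assumes ab: "a * cnj a + b * cnj b = 1"
  shows "herm_proj (cp1_point a b) =
    vector [vector [a * cnj a, a * cnj b], vector [b * cnj a, b * cnj b]]" (is "_ = ?P")
  unfolding herm_proj_def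
proof (rule the_equality)
  have P_apply: "?P *v x = (cnj a * x $ 1 + cnj b * x $ 2) *s vector [a, b]" for x
    by (simp add: vec_eq_iff forall_2 matrix_vector_mult_def sum_2 algebra_simps)
  have "?P *v (k *s vector [a, b]) = k *s vector [a, b]" for k
  proof -
    have "cnj a * (k * a) + cnj b * (k * b) = k"
      using arg_cong[OF ab, of "\<lambda>t. k * t"] by (simp add: algebra_simps)
    then show ?thesis by (simp add: P_apply)
  qed
  then have "range (\<lambda>k. k *s vector [a, b]) \<subseteq> range ((*v) ?P)"
    by (metis image_subsetI rangeI)
  moreover have "range ((*v) ?P) \<subseteq> range (\<lambda>k. k *s vector [a, b])"
    unfolding P_apply by blast
  ultimately have "range ((*v) ?P) = cp1_point a b"
    unfolding cp1_point_def vec.span_singleton by (rule subset_antisym[rotated])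
  moreover have "?P ** ?P = ?P"
  proof -
    have "x * cnj a * (a * cnj y) + x * cnj b * (b * cnj y) = x * cnj y" for x y
      using arg_cong[OF ab, of "\<lambda>t. x * cnj y * t"] by (simp add: algebra_simps)
    then show ?thesis by (intro cmat2_eqI) simp_all
  qed
  moreover have "ctranspose ?P = ?P"
    by (rule cmat2_eqI) simp_all
  ultimately show P: "?P ** ?P = ?P \<and> ctranspose ?P = ?P \<and> range ((*v) ?P) = cp1_point a b"
    by blast
  fix Q
  assume Q: "Q ** Q = Q \<and> ctranspose Q = Q \<and> range ((*v) Q) = cp1_point a b"
  \<comment> \<open>An idempotent is the identity on its range, so it fixes every column of a matrix
    with the same range.\<close>
  have *: "A ** B = B" if A: "A ** A = A" and AB: "range ((*v) A) = range ((*v) B)" for A B :: cmat2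
  proof -
    have "(A ** B) *v x = B *v x" for x
    proof -
      obtain y where "B *v x = A *v y"
        using AB by (metis rangeE rangeI)
      then show ?thesis
        by (metis matrix_vector_mul_assoc A)
    qed
    then show ?thesis by (simp add: matrix_eq)
  qed
  have "?P ** Q = Q" "Q ** ?P = ?P"
    using * P Q by simp_all
  \<comment> \<open>Taking adjoints in \<open>?P ** Q = Q\<close> gives \<open>Q ** ?P = Q\<close>,
    while also \<open>Q ** ?P = ?P\<close>.\<close>
  then show "Q = ?P"
    using ctranspose_mult[of ?P Q] P Q by simp
qed

lemma herm_proj_e1: "herm_proj (cp1_point 1 0) = vector [vector [1, 0], vector [0, 0]]"
  by (subst herm_proj_cp1_point) simp_all

lemma herm_reflection_e1:
  "herm_proj_perp (cp1_point 1 0) - herm_proj (cp1_point 1 0) = vector [vector [-1, 0], vector [0, 1]]"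
  by (rule cmat2_eqI) (simp_all add: herm_proj_perp_def herm_proj_e1 mat_nth)

lemma herm_reflection_conj:
  assumes "L \<in> CP1"
  obtains W where "W \<in> SU2" "herm_proj_perp L - herm_proj L =
    ctranspose W ** (herm_proj_perp (cp1_point 1 0) - herm_proj (cp1_point 1 0)) ** W"
proof -
  obtain a b where ab: "a * cnj a + b * cnj b = 1" and L: "L = cp1_point a b"
    using CP1_unit_vector[OF assms] .
  \<comment> \<open>The first row is the conjugate of the unit vector spanning \<open>L\<close>, and
    the second row annihilates that vector. Hence \<open>W\<close> maps \<open>vector [a, b]\<close>
    to (1, 0).\<close>
  define W :: cmat2 where "W = vector [vector [cnj a, cnj b], vector [- b, a]]"
  have ab': "cnj a * a + cnj b * b = 1" "b * cnj b + a * cnj a = 1"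
    using ab by (simp_all add: mult.commute add.commute)
  have "W ** ctranspose W = mat 1"
    by (rule cmat2_eqI) (use ab' in \<open>simp_all add: W_def mat_nth\<close>)
  moreover have "det W = 1"
    using ab' by (simp add: W_def det_2 mult.commute)
  ultimately have "W \<in> SU2" by (simp add: SU2_def)
  moreover have "herm_proj_perp L - herm_proj L =
      ctranspose W ** (herm_proj_perp (cp1_point 1 0) - herm_proj (cp1_point 1 0)) ** W"
    unfolding herm_reflection_e1 unfolding L herm_proj_perp_def herm_proj_cp1_point[OF ab]
    by (rule cmat2_eqI; simp add: W_def mat_nth; use ab in algebra)
  ultimately show thesis by (rule that)
qed

text \<open>The parameter enters the root only through its square, so changing it by a sign
  \<open>\<epsilon>\<close> leaves the root alone and the sign can be moved onto the
  reflection.\<close>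

lemma simple_factor_conj:
  assumes W: "W \<in> SU2"
    and "\<beta> / \<alpha> = \<epsilon>" "\<alpha> \<noteq> 0" "\<beta>\<^sup>2 = \<alpha>\<^sup>2"
    and refl: "mat \<epsilon> ** (herm_proj_perp L - herm_proj L) =
      ctranspose W ** (herm_proj_perp L' - herm_proj L') ** W"
  shows "simple_factor L \<beta> z = ctranspose W ** simple_factor L' \<alpha> z ** W"
proof -
  define R R' c where "R = herm_proj_perp L - herm_proj L" and "R' = herm_proj_perp L' - herm_proj L'"
    and "c = 1 / csqrt (1 - \<alpha>\<^sup>2 / z\<^sup>2)"
  have "mat (\<beta> / z) ** R = mat (\<alpha> / z) ** (mat \<epsilon> ** R)"
    using assms(2,3) by (intro cmat2_eqI) (auto simp: mat_nth)
  also have "\<dots> = ctranspose W ** (mat (\<alpha> / z) ** R') ** W"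
    using refl by (simp only: R_def R'_def mat_mult_conj)
  finally have "mat 1 + mat (\<beta> / z) ** R = ctranspose W ** (mat 1 + mat (\<alpha> / z) ** R') ** W"
    by (simp add: add_conj SU2_D[OF W])
  then show ?thesis
    unfolding simple_factor_def R_def[symmetric] R'_def[symmetric] assms(4) c_def[symmetric]
    by (simp only: mat_mult_conj)
qed

lemma simple_factor_to_e1:
  assumes L: "L \<in> CP1" and "\<alpha> \<noteq> 0" and "\<beta> = \<alpha> \<or> \<beta> = - \<alpha>"
  obtains W where "W \<in> SU2"
    "\<And>z. simple_factor L \<beta> z = ctranspose W ** simple_factor (cp1_point 1 0) \<alpha> z ** W"
proof -
  let ?R = "\<lambda>L. herm_proj_perp L - herm_proj L"
  obtain W where W: "W \<in> SU2" "?R L = ctranspose W ** ?R (cp1_point 1 0) ** W"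
    using herm_reflection_conj[OF L] .
  from assms(3) show thesis
  proof
    assume "\<beta> = \<alpha>"
    then show thesis
      using that[OF W(1)] simple_factor_conj[OF W(1), of \<beta> \<alpha> 1 L "cp1_point 1 0"] W(2) \<open>\<alpha> \<noteq> 0\<close> by simp
  next
    assume \<beta>: "\<beta> = - \<alpha>"
    \<comment> \<open>\<open>J\<close> exchanges the two coordinate lines and thereby changes the sign of the reflection.\<close>
    define J :: cmat2 where "J = vector [vector [0, 1], vector [-1, 0]]"
    have "J ** ctranspose J = mat 1"
      by (rule cmat2_eqI) (simp_all add: J_def mat_nth)
    then have J: "J \<in> SU2"
      by (simp add: SU2_def J_def det_2)
    have flip: "mat (-1) ** ?R (cp1_point 1 0) = ctranspose J ** ?R (cp1_point 1 0) ** J"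
      unfolding herm_reflection_e1 by (rule cmat2_eqI) (simp_all add: J_def mat_nth)
    have "mat (-1) ** ?R L = ctranspose (J ** W) ** ?R (cp1_point 1 0) ** (J ** W)"
      unfolding W(2) mat_mult_conj ctranspose_mult flip by (simp only: matrix_mul_assoc)
    then show thesis
      using that[OF SU2_mult[OF J W(1)]] \<beta> \<open>\<alpha> \<noteq> 0\<close>
        simple_factor_conj[OF SU2_mult[OF J W(1)], of \<beta> \<alpha> "-1" L "cp1_point 1 0"] by simp
  qed
qed

text \<open>Both \<open>1 - u\<close> and \<open>1 + u\<close> lie in the right half-plane, where
  principal roots multiply, so both sides equal
  \<open>csqrt (1 - u) / csqrt (1 + u)\<close>.\<close>

lemma csqrt_quotient:
  assumes "cmod u < 1"
  shows "(1 - u) / csqrt (1 - u\<^sup>2) = csqrt ((1 - u) / (1 + u))"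
proof -
  have "\<bar>Re u\<bar> < 1"
    using assms abs_Re_le_cmod[of u] by linarith
  then have pos: "Re (1 - u) > 0" "Re (1 + u) > 0" by auto
  \<comment> \<open>Both arguments lie strictly within pi/2 of 0, so their sum stays in (-pi, pi)
    and the product of the roots is again the principal root.\<close>
  have mult: "csqrt (x * y) = csqrt x * csqrt y" if "Re x > 0" "Re y > 0" for x y
    using that Arg_Re_pos[of x] Arg_Re_pos[of y] by (intro csqrt_mult) (auto simp: abs_less_iff)
  have nz: "csqrt (1 - u) \<noteq> 0" "csqrt (1 + u) \<noteq> 0"
    unfolding csqrt_eq_0 using pos by (metis less_irrefl zero_complex.sel(1))+
  have "1 - u\<^sup>2 = (1 - u) * (1 + u)"
    by (simp add: algebra_simps power2_eq_square)
  then have "csqrt (1 - u\<^sup>2) = csqrt (1 - u) * csqrt (1 + u)"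
    using mult[OF pos] by simp
  moreover have "csqrt ((1 - u) / (1 + u)) * csqrt (1 + u) = csqrt (1 - u)"
  proof -
    have "Re (inverse (1 + u)) > 0"
      using pos(2) by (simp add: divide_pos_pos sum_power2_gt_zero_iff)
    moreover have "1 + u \<notin> \<real>\<^sub>\<le>\<^sub>0"
      using pos(2) by (auto simp: complex_nonpos_Reals_iff)
    ultimately show ?thesis
      using mult[OF pos(1), of "inverse (1 + u)"] nz(2) by (simp add: csqrt_inverse divide_inverse)
  qed
  moreover have "1 - u = csqrt (1 - u) * csqrt (1 - u)"
    by (simp flip: power2_eq_square)
  ultimately show ?thesis
    using nz by (simp add: field_simps)
qed

lemma simple_factor_e1:
  assumes "Re \<alpha> = 0" "cmod \<alpha> < cmod z"
  shows "simple_factor (cp1_point 1 0) \<alpha> z =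
    vector [vector [csqrt ((z - \<alpha>) / (z - cnj \<alpha>)), 0],
            vector [0, csqrt ((z - cnj \<alpha>) / (z - \<alpha>))]]"
proof -
  have z: "z \<noteq> 0" using assms(2) by auto
  have cnj: "cnj \<alpha> = - \<alpha>" using assms(1) by (simp add: complex_eq_iff)
  define u where "u = \<alpha> / z"
  have u: "cmod u < 1" using assms(2) z by (simp add: u_def norm_divide)
  have quot: "(z - \<alpha>) / (z - cnj \<alpha>) = (1 - u) / (1 + u)" "(z - cnj \<alpha>) / (z - \<alpha>) = (1 + u) / (1 - u)"
    using z by (simp_all add: u_def cnj divide_simps)
  show ?thesis
    unfolding simple_factor_def herm_reflection_e1 quot
    \<comment> \<open>The diagonal entries are the quotient formula at \<open>u\<close> and at
      \<open>- u\<close>.\<close>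
    using csqrt_quotient[OF u] csqrt_quotient[of "- u"] u
    by (intro cmat2_eqI) (simp_all add: mat_nth u_def power_divide)
qed

subsection \<open>Dressing a rotated frame\<close>

lemma analytic_SL2_on_mult_const:
  assumes "analytic_SL2_on g S" "det A = 1" "det B = 1"
  shows "analytic_SL2_on (\<lambda>z. A ** g z ** B) S"
  using assms unfolding analytic_SL2_on_def
  by (auto simp: det_mul intro!: analytic_intros)

lemma loop_plus_mult_left: "g \<in> loop_plus r \<Longrightarrow> det A = 1 \<Longrightarrow> (\<lambda>z. A ** g z) \<in> loop_plus r"
  using analytic_SL2_on_mult_const[of g "cball 0 r" A "mat 1"] by (simp add: loop_plus_def)

lemma loop_minus_conj:
  assumes "g \<in> loop_minus r" "det A = 1" "det B = 1"
  shows "(\<lambda>z. A ** g z ** B) \<in> loop_minus r"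
proof -
  obtain p where "minus_extension r g p"
    using assms(1) by (auto simp: loop_minus_def)
  then have "minus_extension r (\<lambda>z. A ** g z ** B) (\<lambda>w. A ** p w ** B)"
    using analytic_SL2_on_mult_const[OF _ assms(2,3)] by (simp add: minus_extension_def)
  then show ?thesis
    by (auto simp: loop_minus_def)
qed

text \<open>The minus factor \<open>m\<close> is kept as it stands, and with it the normalisation at
  infinity; only the plus factor is multiplied by the constant \<open>W\<close>.\<close>

lemma dresses_to_conj:
  assumes W: "W \<in> SU2" and g: "\<And>z. g z = ctranspose W ** g' z ** W" and "dresses_to r g h k"
  shows "dresses_to r g' (\<lambda>z. W ** h z) (\<lambda>z. W ** k z)"
proof -
  have g': "g' = (\<lambda>z. W ** g z ** ctranspose W)"
    by (simp add: g matrix_mul_assoc SU2_D[OF W] SU2_cancel[OF W])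
  obtain m where m: "m \<in> loop_minus_1 r" "\<forall>z\<in>sphere 0 r. g z ** h z = k z ** m z"
    using assms(3) by (auto simp: dresses_to_def has_plus_factor_def)
  have "\<forall>z\<in>sphere 0 r. g' z ** (W ** h z) = W ** k z ** m z"
    using m(2) by (simp add: g' matrix_mul_assoc SU2_cancel[OF W] flip: matrix_mul_assoc)
  then show ?thesis
    using assms(3) m(1) SU2_D[OF W] unfolding dresses_to_def has_plus_factor_def
    by (auto simp: g' intro!: loop_minus_conj loop_plus_mult_left)
qed

text \<open>\<open>W\<close> does not depend on the loop parameter, so it passes through the
  derivative on the left and leaves its inverse on the right.\<close>

lemma curve_of_frame_mult_left:
  assumes W: "W \<in> SU2" and "G t \<in> loop_plus r" "r > 0"
  shows "curve_of_frame (\<lambda>t z. W ** G t z) t = W ** curve_of_frame G t ** ctranspose W"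
proof -
  define D :: cmat2 where "D = (\<chi> i j. deriv (\<lambda>z. G t z $ i $ j) 0)"
  have an: "(\<lambda>z. G t z $ i $ j) analytic_on {0}" and "det (G t 0) = 1" for i j
    using assms(2,3) by (auto simp: loop_plus_def analytic_SL2_on_def intro: analytic_on_subset[of _ "cball 0 r"])
  then obtain B where B: "G t 0 ** B = mat 1"
    using invertible_det_nz[of "G t 0"] by (auto simp: invertible_def)
  have "W ** G t 0 ** (B ** ctranspose W) = W ** (G t 0 ** B) ** ctranspose W"
    by (simp only: matrix_mul_assoc)
  also have "\<dots> = mat 1"
    by (simp add: B SU2_D[OF W])
  finally have inv: "matrix_inv (W ** G t 0) = matrix_inv (G t 0) ** ctranspose W"
    by (simp add: matrix_inv_eq[OF B] matrix_inv_eq)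
  \<comment> \<open>\<open>deriv\<close> is a total function and is linear only on differentiable
    functions; this is where analyticity at 0 enters.\<close>
  have diff: "(\<lambda>z. G t z $ i $ j) field_differentiable at 0" for i j
    using an by (rule analytic_on_imp_differentiable_at) simp
  have D': "(\<chi> i j. deriv (\<lambda>z. (W ** G t z) $ i $ j) 0) = W ** D"
    using diff by (simp add: vec_eq_iff D_def field_differentiable_mult)
  show ?thesis
    unfolding curve_of_frame_def D' inv D_def[symmetric]
    by (simp only: scaleR_conj matrix_mul_assoc)
qed

text \<open>The dressed frame \<open>G\<close> becomes \<open>W ** G\<close>; equal moduli of the
  two parameters make the same radius \<open>r\<close> admissible.\<close>

lemma dressed_curve_rotate:
  assumes W: "W \<in> SU2" and h: "\<And>z. simple_factor L \<beta> z = ctranspose W ** simple_factor L' \<alpha> z ** W"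
    and "cmod \<beta> = cmod \<alpha>" and "dressed_curve F L \<beta> c"
  shows "dressed_curve (\<lambda>t z. W ** F t z) L' \<alpha> ((\<lambda>X. W ** X ** ctranspose W) \<circ> c)"
proof -
  obtain r G where r: "r > cmod \<alpha>" and G: "\<And>t. dresses_to r (simple_factor L \<beta>) (F t) (G t)"
    and c: "c = curve_of_frame G"
    using assms(3,4) unfolding dressed_curve_def by auto
  have "r > 0" using r norm_ge_zero[of \<alpha>] by linarith
  moreover have "G t \<in> loop_plus r" for t
    using G by (simp add: dresses_to_def has_plus_factor_def)
  ultimately have "(\<lambda>X. W ** X ** ctranspose W) \<circ> c = curve_of_frame (\<lambda>t z. W ** G t z)"
    by (simp add: fun_eq_iff c curve_of_frame_mult_left[OF W, where r = r])
  then show ?thesis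
    unfolding dressed_curve_def using r dresses_to_conj[OF W h G]
    by (intro exI[of _ r] conjI exI[of _ "\<lambda>t z. W ** G t z"]) simp_all
qed

lemma unit_circle_frames_rotate:
  assumes "W \<in> SU2" "F \<in> unit_circle_frames"
  shows "(\<lambda>t z. W ** F t z) \<in> unit_circle_frames"
  using assms SU2_mult unfolding unit_circle_frames_def by (auto simp: matrix_mul_assoc)

subsection \<open>Resonance points\<close>

text \<open>One closed form for even and odd \<open>n\<close>, built from powers of the scalars
  \<open>\<i> * \<theta>\<close> and \<open>- \<i> * \<theta>\<close>, so that the matrix
  exponential reduces to two scalar exponential series.\<close>

lemma funpow_matrix_mult:
  fixes A :: cmat2
  assumes A: "A ** A = mat (- \<theta>\<^sup>2)" and "\<theta> \<noteq> 0"
  shows "((**) A ^^ n) (mat 1) =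
    mat (((\<i> * \<theta>) ^ n + (- \<i> * \<theta>) ^ n) / 2) + mat (((\<i> * \<theta>) ^ n - (- \<i> * \<theta>) ^ n) / (2 * \<i> * \<theta>)) ** A"
proof (induction n)
  case 0
  then show ?case by (intro cmat2_eqI) (simp_all add: mat_nth)
next
  case (Suc n)
  define p q where "p = (\<i> * \<theta>) ^ n" and "q = (- \<i> * \<theta>) ^ n"
  have "((**) A ^^ Suc n) (mat 1) = A ** (mat ((p + q) / 2) + mat ((p - q) / (2 * \<i> * \<theta>)) ** A)"
    by (simp add: Suc p_def q_def)
  also have "\<dots> = mat ((p + q) / 2) ** A + mat ((p - q) / (2 * \<i> * \<theta>)) ** mat (- \<theta>\<^sup>2)"
    by (metis A mat_comm matrix_add_ldistrib matrix_mul_assoc)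
  also have "\<dots> = mat ((\<i> * \<theta> * p + - \<i> * \<theta> * q) / 2) +
      mat ((\<i> * \<theta> * p - - \<i> * \<theta> * q) / (2 * \<i> * \<theta>)) ** A"
    using \<open>\<theta> \<noteq> 0\<close> by (intro cmat2_eqI) (simp_all add: mat_nth power2_eq_square field_simps)
  finally show ?case by (simp add: p_def q_def)
qed

text \<open>The exponential is cos \<open>\<theta>\<close> times the identity plus
  \<open>sin \<theta> / \<theta>\<close> times \<open>A\<close>; the cosine term does not reach the
  off-diagonal entry.\<close>

lemma mexp_off_diagonal:
  fixes A :: cmat2
  assumes A: "A ** A = mat (- \<theta>\<^sup>2)" and "\<theta> \<noteq> 0"
  shows "mexp A $ 1 $ 2 = sin \<theta> / \<theta> * A $ 1 $ 2"
proof -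
  let ?f = "\<lambda>n. ((**) A ^^ n) (mat 1) /\<^sub>R fact n"
  define M where "M = mat ((exp (\<i> * \<theta>) + exp (- \<i> * \<theta>)) / 2) +
    mat ((exp (\<i> * \<theta>) - exp (- \<i> * \<theta>)) / (2 * \<i> * \<theta>)) ** A"
  have e: "(\<lambda>n. x ^ n / fact n) sums exp x" for x :: complex
    using exp_converges[of x] by (simp add: scaleR_conv_of_real[where 'a=complex] field_simps)
  have "(\<lambda>n. ?f n $ i $ j) sums (M $ i $ j)" for i j
  proof -
    let ?m = "mat 1 $ i $ j :: complex" and ?a = "A $ i $ j"
    have comb: "(mat x + mat y ** A) $ i $ j = x * ?m + y * ?a" for x y
      using exhaust_2[of i] exhaust_2[of j] by (auto simp: mat_nth)
    \<comment> \<open>Stated for arbitrary scalars this is pure distributivity, valid for zero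
      denominators too because division is multiplication by \<open>inverse\<close>.\<close>
    have "inverse F * ((p + q) / 2 * ?m + (p - q) / d * ?a) =
        (p / F + q / F) / 2 * ?m + (p / F - q / F) / d * ?a"
      for p q d F :: complex
      by (simp only: divide_inverse ring_distribs mult.commute mult.left_commute mult.assoc)
    then have "?f n $ i $ j = ((\<i> * \<theta>) ^ n / fact n + (- \<i> * \<theta>) ^ n / fact n) / 2 * ?m +
        ((\<i> * \<theta>) ^ n / fact n - (- \<i> * \<theta>) ^ n / fact n) / (2 * \<i> * \<theta>) * ?a" for n
      unfolding vector_scaleR_component funpow_matrix_mult[OF assms] comb
      by (simp only: scaleR_conv_of_real of_real_inverse of_real_fact)
    moreover have "(\<lambda>n. ((\<i> * \<theta>) ^ n / fact n + (- \<i> * \<theta>) ^ n / fact n) / 2 * ?m +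
        ((\<i> * \<theta>) ^ n / fact n - (- \<i> * \<theta>) ^ n / fact n) / (2 * \<i> * \<theta>) * ?a) sums (M $ i $ j)"
      unfolding M_def comb by (intro sums_add sums_mult2 sums_divide sums_diff e)
    ultimately show ?thesis
      by (simp only:)
  qed
  then have "?f sums M"
    unfolding sums_def by (intro vec_tendstoI) (simp add: sum_component)
  then have "mexp A = M"
    by (simp add: mexp_def sums_iff)
  moreover have "sin \<theta> / \<theta> = (exp (\<i> * \<theta>) - exp (- \<i> * \<theta>)) / (2 * \<i> * \<theta>)"
    by (simp only: sin_exp_eq divide_divide_eq_left mult_minus_left)
  ultimately show ?thesis
    by (simp add: M_def mat_nth)
qed

text \<open>\<open>V z\<close> is traceless with determinant \<open>(1 + z\<^sup>2) / 4\<close>, so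
  by Cayley-Hamilton its square is minus that scalar.\<close>

lemma circle_frame_off_diagonal:
  assumes "\<theta>\<^sup>2 = of_real (t\<^sup>2) * (1 + z\<^sup>2) / 4" "\<theta> \<noteq> 0"
  shows "circle_frame t z $ 1 $ 2 = sin \<theta> / \<theta> * of_real (t / 2)"
proof -
  have "(t *\<^sub>R V z) ** (t *\<^sub>R V z) = mat (- \<theta>\<^sup>2)"
    unfolding assms(1)
    by (rule cmat2_eqI) (simp_all add: V_def mat_nth scaleR_conv_of_real[where 'a=complex]
        power2_eq_square field_simps)
  then show ?thesis
    unfolding circle_frame_def by (subst mexp_off_diagonal[OF _ assms(2)])
      (simp_all add: V_def scaleR_conv_of_real[where 'a=complex])
qed

text \<open>Whether the frame closes up to plus or minus the identity, its off-diagonal entry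
  vanishes, and this forces \<open>sin \<theta> = 0\<close>.\<close>

lemma resonance_point_square:
  assumes "z \<in> resonance_points \<omega>" "\<omega> \<ge> 1"
  obtains k :: nat where "k \<ge> 1" "z\<^sup>2 = of_real ((real k)\<^sup>2 / (real \<omega>)\<^sup>2 - 1)"
proof -
  \<comment> \<open>This is half of t times the root of \<open>1 + z\<^sup>2\<close>, at
    \<open>t = 2 * pi * real \<omega>\<close>.\<close>
  define \<theta> where "\<theta> = of_real (pi * real \<omega>) * csqrt (1 + z\<^sup>2)"
  have sq: "\<theta>\<^sup>2 = of_real ((pi * real \<omega>)\<^sup>2) * (1 + z\<^sup>2)"
    by (simp add: \<theta>_def power_mult_distrib)
  \<comment> \<open>The zeros of \<open>1 + z\<^sup>2\<close> are exactly the two points excluded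
    from the resonance points.\<close>
  have "1 + z\<^sup>2 \<noteq> 0"
  proof
    assume "1 + z\<^sup>2 = 0"
    then have "(z - \<i>) * (z + \<i>) = 0" by (simp add: algebra_simps power2_eq_square)
    then show False using assms(1) by (auto simp: resonance_points_def add_eq_0_iff2)
  qed
  then have "\<theta> \<noteq> 0" using assms(2) by (simp add: \<theta>_def)
  have "circle_frame (2 * pi * real \<omega>) z $ 1 $ 2 = 0"
    using assms(1) by (auto simp: resonance_points_def mat_nth)
  moreover have "circle_frame (2 * pi * real \<omega>) z $ 1 $ 2 = sin \<theta> / \<theta> * of_real (2 * pi * real \<omega> / 2)"
    by (rule circle_frame_off_diagonal) (simp_all add: \<open>\<theta> \<noteq> 0\<close> sq power_mult_distrib)
  ultimately have "sin \<theta> = 0"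
    using \<open>\<theta> \<noteq> 0\<close> assms(2) by simp
  then obtain n :: int where n: "\<theta> = of_real (of_int n * pi)"
    using sin_eq_0 by auto
  \<comment> \<open>Only the square of \<open>n\<close> matters below, so its sign is
    dropped.\<close>
  define k where "k = nat \<bar>n\<bar>"
  have "n \<noteq> 0" using n \<open>\<theta> \<noteq> 0\<close> by auto
  then have "k \<ge> 1" by (simp add: k_def)
  have "complex_of_real ((pi * real \<omega>)\<^sup>2) * (1 + z\<^sup>2) = of_real ((real k * pi)\<^sup>2)"
    unfolding sq[symmetric] n by (simp add: k_def power_mult_distrib)
  then have "complex_of_real ((real \<omega>)\<^sup>2) * (1 + z\<^sup>2) = of_real ((real k)\<^sup>2)"
    by (simp add: power_mult_distrib)
  then have "z\<^sup>2 = of_real ((real k)\<^sup>2 / (real \<omega>)\<^sup>2 - 1)"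
    using assms(2) by (simp add: field_simps)
  with \<open>k \<ge> 1\<close> show thesis by (rule that)
qed

lemma imaginary_resonance_point:
  assumes "z \<in> resonance_points \<omega>" "\<omega> \<ge> 1" "Re z = 0" "z \<noteq> 0"
  obtains k :: nat where "1 \<le> k" "k < \<omega>"
    "z = \<i> * of_real (sqrt (1 - (real k)\<^sup>2 / (real \<omega>)\<^sup>2)) \<or>
     z = - (\<i> * of_real (sqrt (1 - (real k)\<^sup>2 / (real \<omega>)\<^sup>2)))"
proof -
  obtain k :: nat where k: "k \<ge> 1" "z\<^sup>2 = of_real ((real k)\<^sup>2 / (real \<omega>)\<^sup>2 - 1)"
    using resonance_point_square[OF assms(1,2)] .
  define y where "y = Im z"
  have z: "z = \<i> * of_real y" "y \<noteq> 0"
    using assms(3,4) by (auto simp: y_def complex_eq_iff)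
  have y: "y\<^sup>2 = 1 - (real k)\<^sup>2 / (real \<omega>)\<^sup>2"
  proof -
    have "complex_of_real (- (y\<^sup>2)) = of_real ((real k)\<^sup>2 / (real \<omega>)\<^sup>2 - 1)"
      using k(2) by (simp add: z power_mult_distrib)
    then show ?thesis unfolding of_real_eq_iff by simp
  qed
  \<comment> \<open>A non-zero imaginary part makes the quotient
    \<open>(real k)\<^sup>2 / (real \<omega>)\<^sup>2\<close> smaller than 1, hence
    \<open>k < \<omega>\<close>.\<close>
  moreover have "y\<^sup>2 > 0" using z by simp
  ultimately have "(real k)\<^sup>2 / (real \<omega>)\<^sup>2 < 1"
    by linarith
  then have "(real k)\<^sup>2 < (real \<omega>)\<^sup>2"
    using assms(2) by (simp add: divide_less_eq_1)
  then have "k < \<omega>"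
    using power_less_imp_less_base[of "real k" 2 "real \<omega>"] by simp
  moreover have "sqrt (1 - (real k)\<^sup>2 / (real \<omega>)\<^sup>2) = \<bar>y\<bar>"
    by (simp flip: y)
  then have "z = \<i> * of_real (sqrt (1 - (real k)\<^sup>2 / (real \<omega>)\<^sup>2)) \<or>
     z = - (\<i> * of_real (sqrt (1 - (real k)\<^sup>2 / (real \<omega>)\<^sup>2)))"
    by (auto simp: z abs_if)
  ultimately show thesis
    using k(1) that by blast
qed

section \<open>Rotating a given single-circleton to the line [1:0] and a parameter in (0, i)\<close>

theorem lemma5p3:
  fixes \<omega> :: nat and c :: "real \<Rightarrow> complex^2^2"
  assumes "single_circleton \<omega> c"
  shows "\<exists>(k::nat) (\<alpha>::complex) F \<Phi>.
    1 \<le> k \<and> k < \<omega> \<and>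
    \<alpha> = csqrt (of_real ((real k)\<^sup>2 / (real \<omega>)\<^sup>2 - 1)) \<and>
    \<alpha> = \<i> * of_real (sqrt (1 - (real k)\<^sup>2 / (real \<omega>)\<^sup>2)) \<and>
    \<alpha> \<in> open_segment 0 \<i> \<and>
    (\<forall>z. cmod \<alpha> < cmod z \<longrightarrow>
      simple_factor (cp1_point 1 0) \<alpha> z =
        vector [vector [csqrt ((z - \<alpha>) / (z - cnj \<alpha>)), 0],
                vector [0, csqrt ((z - cnj \<alpha>) / (z - \<alpha>))]]) \<and>
    F \<in> unit_circle_frames \<and>
    su2_isometry \<Phi> \<and>
    dressed_curve F (cp1_point 1 0) \<alpha> (\<Phi> \<circ> c)"
proof -
  obtain F L \<beta> where \<omega>: "\<omega> \<ge> 1" and F: "F \<in> unit_circle_frames" and L: "L \<in> CP1"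
    and \<beta>: "Re \<beta> = 0" "\<beta> \<noteq> 0" "\<beta> \<in> resonance_points \<omega>" and c: "dressed_curve F L \<beta> c"
    using assms unfolding single_circleton_def by blast
  obtain k :: nat where k: "1 \<le> k" "k < \<omega>"
    and k\<beta>: "\<beta> = \<i> * of_real (sqrt (1 - (real k)\<^sup>2 / (real \<omega>)\<^sup>2)) \<or>
      \<beta> = - (\<i> * of_real (sqrt (1 - (real k)\<^sup>2 / (real \<omega>)\<^sup>2)))"
    using imaginary_resonance_point[OF \<beta>(3) \<omega> \<beta>(1,2)] .
  define s where "s = sqrt (1 - (real k)\<^sup>2 / (real \<omega>)\<^sup>2)"
  \<comment> \<open>The representative on the positive imaginary axis; the given
    \<open>\<beta>\<close> may be its negative.\<close>
  define \<alpha> where "\<alpha> = \<i> * complex_of_real s"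
  have sgn: "\<beta> = \<alpha> \<or> \<beta> = - \<alpha>"
    using k\<beta> by (simp add: \<alpha>_def s_def)
  have frac: "0 < (real k)\<^sup>2 / (real \<omega>)\<^sup>2" "(real k)\<^sup>2 / (real \<omega>)\<^sup>2 < 1"
    using k by (simp_all add: power_strict_mono)
  then have s: "0 < s" "s < 1"
    by (simp_all add: s_def)
  \<comment> \<open>The radicand is a negative real, whose principal root is \<open>\<i>\<close>
    times a positive real.\<close>
  have 1: "\<alpha> = csqrt (of_real ((real k)\<^sup>2 / (real \<omega>)\<^sup>2 - 1))"
    unfolding csqrt_of_real' using frac by (simp add: \<alpha>_def s_def abs_if)
  have 2: "\<alpha> \<in> open_segment 0 \<i>"
    unfolding in_segment using s by (auto simp: \<alpha>_def scaleR_conv_of_real mult.commute)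
  have "\<alpha> \<noteq> 0" "Re \<alpha> = 0"
    using s by (simp_all add: \<alpha>_def)
  obtain W where W: "W \<in> SU2"
    "\<And>z. simple_factor L \<beta> z = ctranspose W ** simple_factor (cp1_point 1 0) \<alpha> z ** W"
    using simple_factor_to_e1[OF L \<open>\<alpha> \<noteq> 0\<close> sgn] by blast
  have norm_eq: "cmod \<beta> = cmod \<alpha>"
    using sgn by auto
  show ?thesis
    \<comment> \<open>The matrix \<open>W\<close> that straightens \<open>L\<close> supplies both
      the rotated circle frame and the isometry.\<close>
    by (intro exI[of _ k] exI[of _ \<alpha>] exI[of _ "\<lambda>t z. W ** F t z"]
        exI[of _ "\<lambda>X. W ** X ** ctranspose W"] conjI k 1 2 allI impI simple_factor_e1
        unit_circle_frames_rotate su2_isometry_conj dressed_curve_rotate[OF W norm_eq c] W(1) F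
        \<open>Re \<alpha> = 0\<close>)
      (simp_all add: \<alpha>_def s_def)
qed

end
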